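(* Let $c_{n,r}$ ($n=1,2,\ldots$, $r=2,3,\ldots$) be complex numbers such that, for each $n\ge 1$, $$f_n(z) := z+\sum_{r=2}^{\infty} c_{n,r}z^r$$ is an entire function. Set $$C_n := \max_{r=2,3,4,\ldots}\{|c_{n,r}|^{1/(r-1)}\}.$$ Suppose that the series $\sum_{n=1}^{\infty} C_n$ is convergent. Then the sequence of functions (indexed by $N$) $$\mathop{\mathcal{R}}_{n=1}^{N} f_n(z)$$ is uniformly convergent, as $N\to\infty$, on an arbitrary closed disk in $\mathbb{C}$. In particular, the limit function $$\mathop{\mathcal{R}}_{n=1}^{\infty} f_n(z) = \lim_{N\to\infty}\mathop{\mathcal{R}}_{n=1}^{N} f_n(z)$$ is entire.
   Context: For integers $N\ge d$ and functions $f_d,\ldots,f_N$, the finite composition is $\mathop{\mathcal{R}}_{n=d}^{N} f_n(z) := f_d(f_{d+1}(\cdots f_{N-1}(f_N(z))\cdots))$, i.e. $f_d\circ f_{d+1}\circ\cdots\circ f_N$ evaluated at $z$ (the function with the largest index is applied first). *)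

theory Defs
  imports "HOL-Complex_Analysis.Complex_Analysis"
begin

(* f d o f (d+1) o ... o f N; the function with the largest index is applied first.
   For N < d this is the empty composition, i.e. the identity. *)
definition fin_comp :: "(nat \<Rightarrow> 'a \<Rightarrow> 'a) \<Rightarrow> nat \<Rightarrow> nat \<Rightarrow> 'a \<Rightarrow> 'a" where
  "fin_comp f d N = foldr (\<circ>) (map f [d..<Suc N]) id"

definition inf_comp :: "(nat \<Rightarrow> complex \<Rightarrow> complex) \<Rightarrow> nat \<Rightarrow> complex \<Rightarrow> complex" where
  "inf_comp f d z = lim (\<lambda>N. fin_comp f d N z)"

(* GREATEST is the maximum of a possibly infinite set (Max is meant for finite sets only).
   The argument a is the coefficient sequence of a single power series; only the values
   a r with r >= 2 matter. The maximum is attained as soon as the series converges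
   everywhere, see coeff_max_attained. *)
definition coeff_max :: "(nat \<Rightarrow> complex) \<Rightarrow> real" where
  "coeff_max a = (GREATEST x. \<exists>r\<ge>2. x = cmod (a r) powr (1 / (real r - 1)))"

lemma coeff_max_attained:
  assumes "\<And>z. summable (\<lambda>r. a (r + 2) * z ^ (r + 2))"
  shows "\<exists>r\<ge>2. coeff_max a = cmod (a r) powr (1 / (real r - 1))"
    and "\<And>r. r \<ge> 2 \<Longrightarrow> cmod (a r) powr (1 / (real r - 1)) \<le> coeff_max a"
proof -
  define g where "g r = cmod (a r) powr (1 / (real r - 1))" for r
  have g0: "g r \<ge> 0" for r by (simp add: g_def)
  have small: "\<exists>K. \<forall>r\<ge>K. g r \<le> e" if e: "e > 0" for e
  proof -
    define R where "R = max 1 (1 / e)"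
    have R: "R \<ge> 1" "1 / R \<le> e" using e by (auto simp: R_def field_simps max_def)
    have "(\<lambda>r. a (r + 2) * (of_real R) ^ (r + 2)) \<longlonglongrightarrow> 0"
      by (rule summable_LIMSEQ_zero) (rule assms)
    then have "\<forall>\<^sub>F r in sequentially. cmod (a (r + 2) * (of_real R) ^ (r + 2)) < 1"
      by (auto dest: tendstoD[of _ 0 sequentially 1] simp: dist_norm)
    then obtain K where K: "\<And>r. r \<ge> K \<Longrightarrow> cmod (a (r + 2)) * R ^ (r + 2) < 1"
      using R by (auto simp: eventually_sequentially norm_mult norm_power)
    have "g r \<le> e" if r: "r \<ge> K + 2" for r
    proof -
      have "r - 2 + 2 = r" using r by simp
      then have "cmod (a r) * R ^ r < 1" using K[of "r - 2"] r by (metis le_diff_conv2 add_leD2)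
      moreover have "cmod (a r) * R ^ (r - 1) \<le> cmod (a r) * R ^ r"
        using R by (intro mult_left_mono power_increasing) auto
      ultimately have "cmod (a r) \<le> (1 / R) ^ (r - 1)"
        using R by (simp add: field_simps)
      then have "g r \<le> ((1 / R) ^ (r - 1)) powr (1 / (real r - 1))"
        unfolding g_def using r by (intro powr_mono2) auto
      also have "\<dots> = ((1 / R) powr (real r - 1)) powr (1 / (real r - 1))"
        using R r by (subst powr_realpow [symmetric]) (auto simp: of_nat_diff)
      also have "\<dots> = 1 / R" using R r by (simp add: powr_powr)
      finally show ?thesis using R by simp
    qed
    then show ?thesis by blast
  qed
  have "\<exists>m\<ge>2. \<forall>r\<ge>2. g r \<le> g m"
  proof (cases "\<exists>s\<ge>2. g s > 0")
    case True
    then obtain s where s: "s \<ge> 2" "g s > 0" by blast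
    obtain K where K: "\<And>r. r \<ge> K \<Longrightarrow> g r \<le> g s" using small[OF s(2)] by blast
    let ?A = "g ` {2..K + s}"
    have "Max ?A \<in> ?A" using s by (intro Max_in) auto
    then obtain m where m: "m \<ge> 2" "Max ?A = g m" by auto
    have le: "g r \<le> g m" if "2 \<le> r" "r \<le> K + s" for r
      unfolding m(2)[symmetric] using that by (intro Max_ge) auto
    have "g r \<le> g m" if "r \<ge> 2" for r
      using le[of r] le[of s] K[of r] s that by (cases "r \<le> K + s") auto
    then show ?thesis using m by blast
  next
    case False
    then show ?thesis using g0 by (intro exI[of _ 2]) (auto simp: not_less intro: order_trans)
  qed
  then obtain m where m: "m \<ge> 2" "\<And>r. r \<ge> 2 \<Longrightarrow> g r \<le> g m" by blast
  have eq: "coeff_max a = g m"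
    unfolding coeff_max_def g_def[symmetric] using m by (intro Greatest_equality) auto
  show "\<exists>r\<ge>2. coeff_max a = cmod (a r) powr (1 / (real r - 1))"
    using eq m by (auto simp: g_def)
  show "\<And>r. r \<ge> 2 \<Longrightarrow> cmod (a r) powr (1 / (real r - 1)) \<le> coeff_max a"
    using eq m by (auto simp: g_def)
qed

end

theory Submission imports Defs
begin

text \<open>
  The coefficients of \<open>f\<^sub>n\<close> satisfy \<open>\<bar>c\<^sub>n\<^sub>,\<^sub>r\<bar> \<le> C\<^sub>n\<^bsup>r-1\<^esup>\<close>, so \<open>f\<^sub>n\<close> is majorised coefficientwise by
  the Moebius map \<open>M\<^sub>S(x) = x / (1 - S x)\<close> with \<open>S = C\<^sub>n\<close>. These maps form a one-parameter group,
  \<open>M\<^sub>S \<circ> M\<^sub>T = M\<^bsub>S+T\<^esub>\<close>, hence a composition of any number of the \<open>f\<^sub>n\<close> is majorised by \<open>M\<^sub>S\<close>, where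
  \<open>S\<close> is the sum of the constants \<open>C\<^sub>n\<close> involved. The sum of all \<open>C\<^sub>n\<close> over a far tail is small, so
  on a given disk the tail compositions stay away from the pole \<open>1 / S\<close> of the majorant, however
  many functions they contain.

  To avoid working with the coefficients of a composition, domination is expressed through
  difference quotients (\<open>moebius_dominated\<close>). The identity
  \<open>M\<^sub>S(x) - M\<^sub>S(y) = (x - y) / ((1 - S x) (1 - S y))\<close> makes the resulting bound multiplicative under
  composition (\<open>moebius_dominated_comp\<close>), and this one bound yields growth, a Lipschitz constant,
  and closeness to the identity when \<open>S\<close> is small. For the \<open>f\<^sub>n\<close> themselves it follows from the
  coefficient bound (\<open>moebius_dominated_power_series\<close>).

  On the disk of radius \<open>R\<close>, let \<open>F\<^sub>N = f\<^sub>m \<circ> \<dots> \<circ> f\<^sub>N\<close> with \<open>m\<close> so large that the tail sum from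
  \<open>m\<close> on is small compared with \<open>1 / R\<close>. For \<open>N < N'\<close> one has \<open>F\<^bsub>N'\<^esub> = F\<^sub>N \<circ> G\<close> where \<open>G\<close> composes
  the functions with indices in \<open>{N<..N'}\<close>. As \<open>F\<^sub>N\<close> is Lipschitz with a constant independent of \<open>N\<close>
  and \<open>G\<close> tends to the identity, \<open>F\<^sub>N\<close> is uniformly Cauchy
  (\<open>uniformly_Cauchy_on_tail\<close>). Composing with the fixed continuous function
  \<open>f\<^sub>1 \<circ> \<dots> \<circ> f\<^bsub>m-1\<^esub>\<close> preserves this, because the values of the \<open>F\<^sub>N\<close> stay in a compact disk. The
  limit is entire by Weierstrass' theorem.
\<close>

section \<open>Functions dominated by a Moebius map\<close>

text \<open>The right-hand side is \<open>(M\<^sub>S - id)(x) - (M\<^sub>S - id)(y)\<close> with the real factor \<open>x - y\<close> replaced by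
  \<open>\<bar>w - z\<bar>\<close>, where \<open>x = \<bar>w\<bar>\<close> and \<open>y = \<bar>z\<bar>\<close>. Subtracting the identity is what gives
  closeness to the identity for small \<open>S\<close>.\<close>

definition moebius_dominated :: "real \<Rightarrow> (complex \<Rightarrow> complex) \<Rightarrow> bool" where
  "moebius_dominated S F \<longleftrightarrow> F 0 = 0 \<and>
     (\<forall>w z. S * norm w < 1 \<longrightarrow> S * norm z < 1 \<longrightarrow>
        norm ((F w - F z) - (w - z)) \<le> norm (w - z) * (1 / ((1 - S * norm w) * (1 - S * norm z)) - 1))"

lemma moebius_dominated_zero:
  assumes "moebius_dominated S F"
  shows "F 0 = 0"
  using assms by (simp add: moebius_dominated_def)

lemma moebius_dominated_diff:
  assumes "moebius_dominated S F" "S * norm w < 1" "S * norm z < 1"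
  shows "norm ((F w - F z) - (w - z)) \<le> norm (w - z) * (1 / ((1 - S * norm w) * (1 - S * norm z)) - 1)"
  using assms by (simp add: moebius_dominated_def)

lemma moebius_dominated_lipschitz:
  assumes "moebius_dominated S F" "S * norm w < 1" "S * norm z < 1"
  shows "norm (F w - F z) \<le> norm (w - z) * (1 / ((1 - S * norm w) * (1 - S * norm z)))"
  using moebius_dominated_diff[OF assms] norm_triangle_ineq[of "(F w - F z) - (w - z)" "w - z"]
  by (simp add: algebra_simps)

lemma moebius_dominated_growth:
  assumes "moebius_dominated S F" "S * norm z < 1"
  shows "norm (F z) \<le> norm z / (1 - S * norm z)"
  using moebius_dominated_lipschitz[OF assms(1), of z 0] assms
  by (simp add: moebius_dominated_zero)

lemma moebius_dominated_near_id:
  assumes "moebius_dominated S F" "S * norm z < 1"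
  shows "norm (F z - z) \<le> norm z * (1 / (1 - S * norm z) - 1)"
  using moebius_dominated_diff[OF assms(1), of z 0] assms
  by (simp add: moebius_dominated_zero)

text \<open>The bound \<open>\<bar>G w\<bar> \<le> M\<^sub>T(\<bar>w\<bar>)\<close> gives \<open>(1 - S \<bar>G w\<bar>) (1 - T \<bar>w\<bar>) \<ge> 1 - (S + T) \<bar>w\<bar>\<close>: the denominators
  multiply exactly as for the Moebius maps themselves.\<close>

lemma moebius_dominated_comp:
  assumes F: "moebius_dominated S F" and G: "moebius_dominated T G" and S: "S \<ge> 0" and T: "T \<ge> 0"
  shows "moebius_dominated (S + T) (F \<circ> G)"
  unfolding moebius_dominated_def
proof (intro conjI allI impI)
  show "(F \<circ> G) 0 = 0"
    by (simp add: moebius_dominated_zero[OF F] moebius_dominated_zero[OF G])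
next
  fix w z :: complex
  assume w: "(S + T) * norm w < 1" and z: "(S + T) * norm z < 1"
  have T_less: "T * norm u < 1" if "(S + T) * norm u < 1" for u :: complex
  proof -
    have "T * norm u \<le> (S + T) * norm u" using S by (intro mult_right_mono) auto
    then show ?thesis using that by linarith
  qed
  have denom: "1 - (S + T) * norm u \<le> (1 - S * norm (G u)) * (1 - T * norm u)"
    if "(S + T) * norm u < 1" for u
  proof -
    have pos: "1 - T * norm u > 0" using T_less[OF that] by simp
    have "norm (G u) * (1 - T * norm u) \<le> norm u"
      using moebius_dominated_growth[OF G T_less[OF that]] pos by (simp add: field_simps)
    from mult_left_mono[OF this S] show ?thesis by (simp add: algebra_simps)
  qed
  have inner: "S * norm (G u) < 1" if "(S + T) * norm u < 1" for u
  proof -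
    have "0 < (1 - S * norm (G u)) * (1 - T * norm u)" using denom[OF that] that by linarith
    then show ?thesis using T_less[OF that] by (simp add: zero_less_mult_iff)
  qed
  define d where "d = norm (w - z)"
  define A where "A = 1 / ((1 - S * norm (G w)) * (1 - S * norm (G z)))"
  define B where "B = 1 / ((1 - T * norm w) * (1 - T * norm z))"
  have A1: "A \<ge> 1"
  proof -
    have "(1 - S * norm (G w)) * (1 - S * norm (G z)) \<le> 1"
      using inner[OF w] inner[OF z] S by (intro mult_le_one) auto
    then show ?thesis
      unfolding A_def using inner[OF w] inner[OF z]
      by (subst le_divide_eq_1_pos) (auto intro!: mult_pos_pos)
  qed
  have "norm ((F (G w) - F (G z)) - (w - z))
      \<le> norm ((F (G w) - F (G z)) - (G w - G z)) + norm ((G w - G z) - (w - z))"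
    using norm_triangle_ineq[of "(F (G w) - F (G z)) - (G w - G z)" "(G w - G z) - (w - z)"]
    by (simp add: algebra_simps)
  also have "\<dots> \<le> norm (G w - G z) * (A - 1) + d * (B - 1)"
    unfolding A_def B_def d_def
    by (intro add_mono moebius_dominated_diff[OF F] moebius_dominated_diff[OF G] inner T_less w z)
  also have "\<dots> \<le> (d * B) * (A - 1) + d * (B - 1)"
    unfolding B_def d_def using A1
    by (intro add_right_mono mult_right_mono moebius_dominated_lipschitz[OF G] T_less w z) auto
  also have "\<dots> = d * (A * B - 1)"
    by (simp add: algebra_simps)
  also have "\<dots> \<le> d * (1 / ((1 - (S + T) * norm w) * (1 - (S + T) * norm z)) - 1)"
  proof (intro mult_left_mono diff_right_mono)
    have "A * B = 1 / (((1 - S * norm (G w)) * (1 - T * norm w)) * ((1 - S * norm (G z)) * (1 - T * norm z)))"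
      by (simp add: A_def B_def mult_ac)
    also have "\<dots> \<le> 1 / ((1 - (S + T) * norm w) * (1 - (S + T) * norm z))"
    proof (rule divide_left_mono)
      show "(1 - (S + T) * norm w) * (1 - (S + T) * norm z)
          \<le> ((1 - S * norm (G w)) * (1 - T * norm w)) * ((1 - S * norm (G z)) * (1 - T * norm z))"
        using w z denom[OF w] denom[OF z] by (intro mult_mono) linarith+
    next
      show "0 < ((1 - S * norm (G w)) * (1 - T * norm w)) * ((1 - S * norm (G z)) * (1 - T * norm z))
             * ((1 - (S + T) * norm w) * (1 - (S + T) * norm z))"
        using w z T_less[OF w] T_less[OF z] inner[OF w] inner[OF z] by (intro mult_pos_pos) auto
    qed simp
    finally show "A * B \<le> 1 / ((1 - (S + T) * norm w) * (1 - (S + T) * norm z))" .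
  qed (simp add: d_def)
  finally show "norm (((F \<circ> G) w - (F \<circ> G) z) - (w - z))
      \<le> norm (w - z) * (1 / ((1 - (S + T) * norm w) * (1 - (S + T) * norm z)) - 1)"
    by (simp add: d_def)
qed

text \<open>Dividing \<open>w\<^bsup>k+1\<^esup> - z\<^bsup>k+1\<^esup>\<close> by \<open>w - z\<close> leaves \<open>\<Sum>i\<le>k. w\<^bsup>i\<^esup> z\<^bsup>k-i\<^esup>\<close>. Weighted with \<open>C\<^bsup>k\<^esup>\<close>, these are in
  absolute value the terms of the Cauchy product of two geometric series with ratios
  \<open>C \<bar>w\<bar>\<close> and \<open>C \<bar>z\<bar>\<close>; the term \<open>k = 0\<close> is the contribution of the identity.\<close>

lemma moebius_dominated_power_series:
  fixes a :: "nat \<Rightarrow> complex"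
  assumes summable: "\<And>z. summable (\<lambda>r. a (r + 2) * z ^ (r + 2))"
    and F_eq: "\<And>z. F z = z + (\<Sum>r. a (r + 2) * z ^ (r + 2))"
    and C: "C \<ge> 0"
    and coeff: "\<And>r. norm (a (r + 2)) \<le> C ^ (r + 1)"
  shows "moebius_dominated C F"
  unfolding moebius_dominated_def
proof (intro conjI allI impI)
  show "F 0 = 0" by (simp add: F_eq)
next
  fix w z :: complex
  assume w: "C * norm w < 1" and z: "C * norm z < 1"
  define q where "q k = (\<Sum>i\<le>k. (C * norm w) ^ i * (C * norm z) ^ (k - i))" for k
  have "q sums ((\<Sum>k. (C * norm w) ^ k) * (\<Sum>k. (C * norm z) ^ k))"
    unfolding q_def[abs_def] using w z C
    by (intro Cauchy_product_sums) (auto simp: norm_power norm_mult intro!: summable_geometric)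
  then have "q sums (1 / ((1 - C * norm w) * (1 - C * norm z)))"
    using w z C by (simp add: suminf_geometric)
  then have q: "(\<lambda>r. q (Suc r)) sums (1 / ((1 - C * norm w) * (1 - C * norm z)) - 1)"
    by (subst sums_Suc_iff) (simp add: q_def)
  have term_le: "norm (a (r + 2) * w ^ (r + 2) - a (r + 2) * z ^ (r + 2)) \<le> norm (w - z) * q (Suc r)" for r
  proof -
    have "norm (w ^ (r + 2) - z ^ (r + 2))
        = norm (w - z) * norm (\<Sum>i\<le>Suc r. w ^ i * z ^ (Suc r - i))"
      using diff_power_eq_sum[of w "Suc r" z]
      by (simp only: norm_mult add_2_eq_Suc' lessThan_Suc_atMost)
    also have "\<dots> \<le> norm (w - z) * (\<Sum>i\<le>Suc r. norm w ^ i * norm z ^ (Suc r - i))"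
      by (intro mult_left_mono sum_norm_le) (auto simp: norm_mult norm_power)
    finally have "norm (a (r + 2)) * norm (w ^ (r + 2) - z ^ (r + 2))
        \<le> C ^ (r + 1) * (norm (w - z) * (\<Sum>i\<le>Suc r. norm w ^ i * norm z ^ (Suc r - i)))"
      using coeff C by (intro mult_mono) auto
    also have "\<dots> = norm (w - z) * (\<Sum>i\<le>Suc r. C ^ Suc r * (norm w ^ i * norm z ^ (Suc r - i)))"
      by (simp only: Suc_eq_plus1 mult.left_commute[of _ "norm (w - z)"] flip: sum_distrib_left)
    also have "(\<Sum>i\<le>Suc r. C ^ Suc r * (norm w ^ i * norm z ^ (Suc r - i))) = q (Suc r)"
      unfolding q_def
    proof (rule sum.cong)
      fix i assume "i \<in> {..Suc r}"
      then have "C ^ Suc r = C ^ i * C ^ (Suc r - i)" by (simp flip: power_add)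
      then show "C ^ Suc r * (norm w ^ i * norm z ^ (Suc r - i)) = (C * norm w) ^ i * (C * norm z) ^ (Suc r - i)"
        by (simp only: power_mult_distrib mult_ac)
    qed simp
    finally show ?thesis by (simp add: norm_mult flip: right_diff_distrib)
  qed
  have "(F w - F z) - (w - z) = (\<Sum>r. a (r + 2) * w ^ (r + 2) - a (r + 2) * z ^ (r + 2))"
    using suminf_diff[OF summable summable, of w z] by (simp add: F_eq)
  also have "norm \<dots> \<le> (\<Sum>r. norm (w - z) * q (Suc r))"
    using q by (intro norm_suminf_le term_le summable_mult) (simp add: sums_iff)
  also have "\<dots> = norm (w - z) * (1 / ((1 - C * norm w) * (1 - C * norm z)) - 1)"
    using q by (simp add: suminf_mult sums_iff)
  finally show "norm ((F w - F z) - (w - z)) \<le> norm (w - z) * (1 / ((1 - C * norm w) * (1 - C * norm z)) - 1)" .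
qed

section \<open>Finite compositions\<close>

lemma fin_comp_empty: "N < d \<Longrightarrow> fin_comp f d N = id"
  by (simp add: fin_comp_def)

lemma fin_comp_Suc: "d \<le> Suc N \<Longrightarrow> fin_comp f d (Suc N) = fin_comp f d N \<circ> f (Suc N)"
proof -
  assume "d \<le> Suc N"
  have "foldr (\<circ>) fs g = foldr (\<circ>) fs id \<circ> g" for fs :: "('a \<Rightarrow> 'a) list" and g
    by (induction fs) (auto simp: comp_assoc)
  from this[of "map f [d..<Suc N]" "f (Suc N)"] \<open>d \<le> Suc N\<close> show ?thesis
    by (simp add: fin_comp_def)
qed

lemma fin_comp_split:
  assumes "d \<le> Suc k" "k \<le> N"
  shows "fin_comp f d N = fin_comp f d k \<circ> fin_comp f (Suc k) N"
  using assms(2)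
proof (induction N rule: dec_induct)
  case base
  then show ?case by (simp add: fin_comp_empty)
next
  case (step N)
  then show ?case using assms(1) by (simp add: fin_comp_Suc comp_assoc)
qed

lemma holomorphic_on_fin_comp:
  assumes "\<And>n. n \<ge> d \<Longrightarrow> f n holomorphic_on UNIV"
  shows "fin_comp f d N holomorphic_on UNIV"
proof (induction N)
  case 0
  have "fin_comp f d 0 = (if d = 0 then f 0 else id)" by (simp add: fin_comp_def)
  then show ?case using assms[of 0] by (auto intro!: holomorphic_intros simp: id_def)
next
  case (Suc N)
  show ?case
  proof (cases "d \<le> Suc N")
    case True
    then show ?thesis unfolding fin_comp_Suc[OF True]
      by (intro holomorphic_on_compose_gen[OF assms Suc]) auto
  next
    case False
    then show ?thesis by (simp add: fin_comp_empty id_def)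
  qed
qed

lemma moebius_dominated_fin_comp:
  assumes "\<And>n. n \<ge> d \<Longrightarrow> moebius_dominated (C n) (f n)" "\<And>n. n \<ge> d \<Longrightarrow> C n \<ge> 0" "d \<ge> 1"
  shows "moebius_dominated (sum C {d..<Suc N}) (fin_comp f d N)"
proof (induction N)
  case 0
  then show ?case using assms(3) by (simp add: fin_comp_empty moebius_dominated_def)
next
  case (Suc N)
  show ?case
  proof (cases "d \<le> Suc N")
    case True
    then have "moebius_dominated (sum C {d..<Suc N} + C (Suc N)) (fin_comp f d N \<circ> f (Suc N))"
      using assms by (intro moebius_dominated_comp Suc sum_nonneg) auto
    moreover have "sum C {d..<Suc (Suc N)} = sum C {d..<Suc N} + C (Suc N)"
      using True by simp
    ultimately show ?thesis by (simp only: fin_comp_Suc[OF True])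
  next
    case False
    then show ?thesis by (simp add: fin_comp_empty moebius_dominated_def)
  qed
qed

section \<open>Uniform convergence\<close>

text \<open>Every composition whose constants sum to at most \<open>1 / (4 R)\<close> maps the disk of radius \<open>R\<close> into the
  disk of radius \<open>2 R\<close>, on which it has Lipschitz constant \<open>4\<close>.\<close>

lemma uniformly_Cauchy_on_tail:
  fixes f :: "nat \<Rightarrow> complex \<Rightarrow> complex" and C :: "nat \<Rightarrow> real"
  assumes dom: "\<And>n. n \<ge> m \<Longrightarrow> moebius_dominated (C n) (f n)"
    and C: "\<And>n. n \<ge> m \<Longrightarrow> C n \<ge> 0" and m: "m \<ge> 1"
    and R: "R > 0"
    and small: "\<And>n. sum C {m..<n} \<le> 1 / (4 * R)"
    and summable: "summable C"
  shows "uniformly_Cauchy_on (cball 0 R) (\<lambda>N. fin_comp f m N)"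
    and "\<And>N z. z \<in> cball 0 R \<Longrightarrow> fin_comp f m N z \<in> cball 0 (2 * R)"
proof -
  have prod_le: "S * norm z \<le> 1 / 2" if "0 \<le> S" "S \<le> 1 / (4 * R)" "norm z \<le> 2 * R" for S and z :: complex
    using mult_mono[OF that(2) that(3)] that(1) R by simp
  have maps: "norm (F z) \<le> 2 * R"
    if F: "moebius_dominated S F" and S: "0 \<le> S" "S \<le> 1 / (4 * R)" and z: "norm z \<le> R" for S F z
  proof -
    have Sz: "S * norm z \<le> 1 / 2" using prod_le[OF S, of z] z R by simp
    then have "norm (F z) \<le> norm z / (1 - S * norm z)"
      by (intro moebius_dominated_growth[OF F]) simp
    also have "\<dots> \<le> R / (1 / 2)" using Sz z R by (intro frac_le) auto
    finally show ?thesis by simp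
  qed
  show "fin_comp f m N z \<in> cball 0 (2 * R)" if "z \<in> cball 0 R" for N z
  proof -
    have "moebius_dominated (sum C {m..<Suc N}) (fin_comp f m N)"
      using dom C m by (intro moebius_dominated_fin_comp)
    moreover have "0 \<le> sum C {m..<Suc N}" using C by (intro sum_nonneg) auto
    ultimately have "norm (fin_comp f m N z) \<le> 2 * R"
      using maps[of "sum C {m..<Suc N}" "fin_comp f m N" z] small[of "Suc N"] that
      by (simp del: sum.op_ivl_Suc)
    then show ?thesis by simp
  qed
  show "uniformly_Cauchy_on (cball 0 R) (\<lambda>N. fin_comp f m N)"
  proof (rule uniformly_Cauchy_onI')
    fix e :: real assume e: "e > 0"
    \<comment> \<open>Below, \<open>G\<close> moves points of the disk by at most \<open>2 R\<^sup>2 \<eta>\<close>, and \<open>F\<close> expands by at most \<open>4\<close>.\<close>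
    define \<eta> where "\<eta> = e / (8 * R ^ 2)"
    have "\<eta> > 0" using e R by (simp add: \<eta>_def)
    then obtain K where K: "\<And>k n. k \<ge> K \<Longrightarrow> norm (sum C {k..<n}) < \<eta>"
      using summable unfolding summable_Cauchy by blast
    have "dist (fin_comp f m N z) (fin_comp f m N' z) < e"
      if z: "z \<in> cball 0 R" and N: "N \<ge> max K m" and N': "N' > N" for z N N'
    proof -
      define F where "F = fin_comp f m N"
      define G where "G = fin_comp f (Suc N) N'"
      define S where "S = sum C {m..<Suc N}"
      define T where "T = sum C {Suc N..<Suc N'}"
      have F: "moebius_dominated S F"
        unfolding S_def F_def using dom C m by (intro moebius_dominated_fin_comp)
      have G: "moebius_dominated T G"
        unfolding T_def G_def using dom C N by (intro moebius_dominated_fin_comp) auto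
      have S: "0 \<le> S" "S \<le> 1 / (4 * R)"
        unfolding S_def using C small by (auto simp del: sum.op_ivl_Suc intro!: sum_nonneg)
      have T0: "0 \<le> T" unfolding T_def using C N by (intro sum_nonneg) auto
      have "T \<le> sum C {m..<Suc N'}"
        unfolding T_def using C N by (intro sum_mono2) auto
      then have T: "T \<le> 1 / (4 * R)" using small[of "Suc N'"] by linarith
      have T\<eta>: "T < \<eta>" using K[of "Suc N" "Suc N'"] N unfolding T_def by simp
      have zR: "norm z \<le> R" using z by simp
      have Gz: "norm (G z) \<le> 2 * R" by (rule maps[OF G T0 T zR])
      have Tz: "T * norm z \<le> 1 / 2" using prod_le[OF T0 T, of z] zR R by simp
      have "norm (G z - z) \<le> norm z * (1 / (1 - T * norm z) - 1)"
        using Tz by (intro moebius_dominated_near_id[OF G]) simp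
      also have "\<dots> = norm z * ((T * norm z) / (1 - T * norm z))"
        using Tz by (simp add: field_simps)
      also have "\<dots> \<le> R * ((T * R) / (1 / 2))"
      proof (rule mult_mono)
        show "(T * norm z) / (1 - T * norm z) \<le> (T * R) / (1 / 2)"
          using Tz T0 R mult_left_mono[OF zR T0] by (intro frac_le) simp_all
      qed (use zR R T0 Tz in simp_all)
      finally have near: "norm (G z - z) \<le> 2 * R ^ 2 * T" by (simp add: power2_eq_square mult_ac)
      have Su: "S * norm u \<le> 1 / 2" if "norm u \<le> 2 * R" for u :: complex
        using prod_le[OF S that] .
      have Sw: "S * norm (G z) \<le> 1 / 2" "S * norm z \<le> 1 / 2" using Su Gz zR R by auto
      have "norm (F (G z) - F z) \<le> norm (G z - z) * (1 / ((1 - S * norm (G z)) * (1 - S * norm z)))"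
        using Sw by (intro moebius_dominated_lipschitz[OF F]) auto
      also have "\<dots> \<le> norm (G z - z) * (1 / (1 / 2 * (1 / 2)))"
      proof (intro mult_left_mono divide_left_mono)
        show "1 / 2 * (1 / 2) \<le> (1 - S * norm (G z)) * (1 - S * norm z)"
          using Sw by (intro mult_mono) simp_all
        show "0 < (1 - S * norm (G z)) * (1 - S * norm z) * (1 / 2 * (1 / 2))"
          using Sw by (intro mult_pos_pos) simp_all
      qed simp_all
      also have "\<dots> \<le> 8 * R ^ 2 * T" using near by (simp add: mult_ac)
      also have "\<dots> < 8 * R ^ 2 * \<eta>" using T\<eta> R by simp
      also have "\<dots> = e" using R by (simp add: \<eta>_def)
      finally have "norm (F (G z) - F z) < e" .
      moreover have "fin_comp f m N' = F \<circ> G"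
        unfolding F_def G_def using N N' by (intro fin_comp_split) auto
      ultimately show ?thesis by (simp add: F_def dist_norm norm_minus_commute)
    qed
    then show "\<exists>M. \<forall>z\<in>cball 0 R. \<forall>N\<ge>M. \<forall>N'>N. dist (fin_comp f m N z) (fin_comp f m N' z) < e"
      by blast
  qed
qed

lemma uniformly_Cauchy_on_compose:
  assumes g: "uniformly_Cauchy_on X g" and h: "uniformly_continuous_on U h"
    and U: "\<And>n x. x \<in> X \<Longrightarrow> g n x \<in> U"
  shows "uniformly_Cauchy_on X (\<lambda>n x. h (g n x))"
proof (rule uniformly_Cauchy_onI)
  fix e :: real assume "e > 0"
  then obtain d where d: "d > 0" "\<And>x y. x \<in> U \<Longrightarrow> y \<in> U \<Longrightarrow> dist x y < d \<Longrightarrow> dist (h x) (h y) < e"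
    using h unfolding uniformly_continuous_on_def by metis
  obtain M where "\<forall>x\<in>X. \<forall>m\<ge>M. \<forall>n\<ge>M. dist (g m x) (g n x) < d"
    using g d(1) unfolding uniformly_Cauchy_on_def by blast
  then show "\<exists>M. \<forall>x\<in>X. \<forall>m\<ge>M. \<forall>n\<ge>M. dist (h (g m x)) (h (g n x)) < e"
    using d(2) U by blast
qed

text \<open>The first \<open>K\<close> functions, with \<open>K\<close> depending on the disk, may leave the domain where the
  Moebius bound is available; as a fixed outer function they are only needed to be uniformly
  continuous on the disk containing the values of the tail.\<close>

lemma uniformly_convergent_fin_comp:
  fixes f :: "nat \<Rightarrow> complex \<Rightarrow> complex" and C :: "nat \<Rightarrow> real"
  assumes dom: "\<And>n. n \<ge> 1 \<Longrightarrow> moebius_dominated (C n) (f n)"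
    and C: "\<And>n. n \<ge> 1 \<Longrightarrow> C n \<ge> 0"
    and holo: "\<And>n. n \<ge> 1 \<Longrightarrow> f n holomorphic_on UNIV"
    and summable: "summable C"
    and R: "R > 0"
  shows "uniformly_convergent_on (cball 0 R) (\<lambda>N. fin_comp f 1 N)"
proof -
  have "1 / (4 * R) > 0" using R by simp
  then obtain K where K: "\<And>k n. k \<ge> K \<Longrightarrow> norm (sum C {k..<n}) < 1 / (4 * R)"
    using summable unfolding summable_Cauchy by blast
  have small: "sum C {Suc K..<n} \<le> 1 / (4 * R)" for n
    using K[of "Suc K" n] by simp
  have tail: "uniformly_Cauchy_on (cball 0 R) (\<lambda>N. fin_comp f (Suc K) N)"
    "\<And>N z. z \<in> cball 0 R \<Longrightarrow> fin_comp f (Suc K) N z \<in> cball 0 (2 * R)"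
    using dom C by (intro uniformly_Cauchy_on_tail[where C = C] R small summable; simp)+
  have "continuous_on UNIV (fin_comp f 1 K)"
    by (intro holomorphic_on_imp_continuous_on holomorphic_on_fin_comp holo)
  then have "uniformly_continuous_on (cball 0 (2 * R)) (fin_comp f 1 K)"
    by (rule compact_uniformly_continuous[OF continuous_on_subset]) auto
  then have "uniformly_Cauchy_on (cball 0 R) (\<lambda>N z. fin_comp f 1 K (fin_comp f (Suc K) N z))"
    by (rule uniformly_Cauchy_on_compose[OF tail(1) _ tail(2)])
  then have "uniformly_convergent_on (cball 0 R) (\<lambda>N z. fin_comp f 1 K (fin_comp f (Suc K) N z))"
    by (rule Cauchy_uniformly_convergent)
  moreover have "fin_comp f 1 K (fin_comp f (Suc K) N z) = fin_comp f 1 N z" if "K \<le> N" for N z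
    using that by (subst fin_comp_split[of 1 K N]) simp_all
  then have "\<forall>\<^sub>F N in sequentially. \<forall>z\<in>cball 0 R.
      fin_comp f 1 K (fin_comp f (Suc K) N z) = fin_comp f 1 N z"
    using eventually_sequentially by blast
  ultimately show ?thesis
    by (rule iffD1[OF uniformly_convergent_cong[OF _ refl], rotated])
qed

section \<open>Infinite compositions of entire functions\<close>

lemma coeff_le_coeff_max_power:
  assumes "\<And>z. summable (\<lambda>r. a (r + 2) * z ^ (r + 2))"
  shows "coeff_max a \<ge> 0" and "cmod (a (r + 2)) \<le> coeff_max a ^ (r + 1)"
proof -
  show nonneg: "coeff_max a \<ge> 0"
    using coeff_max_attained(1)[OF assms] by auto
  have "cmod (a (r + 2)) powr (1 / (real r + 1)) \<le> coeff_max a"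
    using coeff_max_attained(2)[OF assms, of "r + 2"] by (simp add: algebra_simps)
  then have "(cmod (a (r + 2)) powr (1 / (real r + 1))) ^ (r + 1) \<le> coeff_max a ^ (r + 1)"
    by (intro power_mono) auto
  moreover have "(cmod (a (r + 2)) powr (1 / (real r + 1))) ^ (r + 1) = cmod (a (r + 2))"
  proof (cases "a (r + 2) = 0")
    case False
    then show ?thesis
      by (subst powr_realpow [symmetric]) (simp_all add: powr_powr add.commute)
  qed simp
  ultimately show "cmod (a (r + 2)) \<le> coeff_max a ^ (r + 1)" by simp
qed

theorem theorem1p1:
  fixes c :: "nat \<Rightarrow> nat \<Rightarrow> complex" and f :: "nat \<Rightarrow> complex \<Rightarrow> complex"
  assumes summable_f: "\<And>n z. n \<ge> 1 \<Longrightarrow> summable (\<lambda>r. c n (r + 2) * z ^ (r + 2))"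
    and f_eq: "\<And>n z. n \<ge> 1 \<Longrightarrow> f n z = z + (\<Sum>r. c n (r + 2) * z ^ (r + 2))"
    and entire_f: "\<And>n. n \<ge> 1 \<Longrightarrow> f n holomorphic_on UNIV"
    and summable_C: "summable (\<lambda>n. coeff_max (c (n + 1)))"
  shows "(\<forall>a R. uniformly_convergent_on (cball a R) (\<lambda>N. fin_comp f 1 N)) \<and>
         (\<forall>z. (\<lambda>N. fin_comp f 1 N z) \<longlonglongrightarrow> inf_comp f 1 z) \<and>
         inf_comp f 1 holomorphic_on UNIV"
proof -
  define C where "C n = coeff_max (c n)" for n
  have summable: "summable C"
    using summable_C summable_iff_shift[of C 1] by (simp add: C_def)
  have C: "C n \<ge> 0" if "n \<ge> 1" for n
    unfolding C_def using coeff_le_coeff_max_power(1) summable_f[OF that] .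
  have dom: "moebius_dominated (C n) (f n)" if "n \<ge> 1" for n
    using moebius_dominated_power_series[OF summable_f[OF that] f_eq[OF that] C[OF that]]
      coeff_le_coeff_max_power(2)[OF summable_f[OF that]]
    by (simp add: C_def)
  have conv: "uniformly_convergent_on (cball a R) (\<lambda>N. fin_comp f 1 N)" for a R
  proof (rule uniformly_convergent_on_subset)
    show "uniformly_convergent_on (cball 0 (norm a + \<bar>R\<bar> + 1)) (\<lambda>N. fin_comp f 1 N)"
      by (intro uniformly_convergent_fin_comp[of C] dom C entire_f summable) (auto simp: add_nonneg_pos)
    show "cball a R \<subseteq> cball 0 (norm a + \<bar>R\<bar> + 1)"
      by (subst cball_subset_cball_iff) (auto simp: dist_norm)
  qed
  then have lim: "uniform_limit (cball a R) (fin_comp f 1) (inf_comp f 1) sequentially" for a R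
    by (simp add: uniformly_convergent_uniform_limit_iff inf_comp_def[abs_def])
  have "(\<lambda>N. fin_comp f 1 N z) \<longlonglongrightarrow> inf_comp f 1 z" for z
    using lim[of z 1] by (rule tendsto_uniform_limitI) simp
  moreover have "inf_comp f 1 holomorphic_on UNIV"
  proof (rule holomorphic_uniform_sequence)
    show "\<exists>d>0. cball z d \<subseteq> UNIV \<and> uniform_limit (cball z d) (fin_comp f 1) (inf_comp f 1) sequentially" for z
      using lim[of z 1] zero_less_one by blast
  qed (simp_all only: open_UNIV holomorphic_on_fin_comp entire_f)
  ultimately show ?thesis using conv by blast
qed

end
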